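(* Let $E_e$ be the edge vectors on the plabic network $(\mathcal N,\mathcal O,\mathfrak l)$. (1) Let $u$ be a trivalent white vertex with incoming edge $e_3$ and outgoing edges $e_1,e_2$, let $t_u>0$, and let $\tilde{\mathcal N}$ be obtained from $\mathcal N$ by the weight gauge transformation at $u$: $\tilde w_{e_1}=t_uw_{e_1}$, $\tilde w_{e_2}=t_uw_{e_2}$, $\tilde w_{e_3}=t_u^{-1}w_{e_3}$, all other weights unchanged. Then the edge vectors $\tilde E_e$ of $(\tilde{\mathcal N},\mathcal O,\mathfrak l)$ are $$\tilde E_e=\begin{cases}E_e & e\neq e_1,e_2,\\ t_uE_e & e=e_1,e_2.\end{cases}$$ (2) Let $v$ be a trivalent black vertex with incoming edges $e_2,e_3$ and outgoing edge $e_1$, let $t_v>0$, and let $\tilde{\mathcal N}$ be obtained from $\mathcal N$ by the weight gauge transformation at $v$: $\tilde w_{e_1}=t_vw_{e_1}$, $\tilde w_{e_2}=t_v^{-1}w_{e_2}$, $\tilde w_{e_3}=t_v^{-1}w_{e_3}$, all other weights unchanged. Then the edge vectors $\tilde E_e$ of $(\tilde{\mathcal N},\mathcal O,\mathfrak l)$ are $$\tilde E_e=\begin{cases}E_e & e\neq e_1,\\ t_vE_e & e=e_1.\end{cases}$$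
   Context: **Plabic networks.** Let $D$ be a closed convex disk whose boundary contains a straight segment. A plabic graph is a finite directed planar graph embedded in $D$ with straight edges. It has boundary vertices $b_1,\dots,b_n$ on the segment, labelled clockwise, each of degree 1 (a source if its edge is outgoing, a sink otherwise). The remaining (internal) vertices lie inside $D$ and have degree 2 or 3. No component is isolated from the boundary. The graph is perfect: each internal vertex has exactly one incoming edge (then it is white) or exactly one outgoing edge (then it is black); bivalent vertices have one incoming and one outgoing edge and either color. The orientation $\mathcal O$ is called a perfect orientation. A network $\mathcal N$ has a positive weight $w_e$ on each directed edge. **Gauge rays.** A gauge ray direction $\mathfrak l$ is an oriented direction, not parallel to any edge, such that the rays with direction $\mathfrak l$ starting at boundary vertices point inside $D$ and contain no internal vertices. The gauge rays are those starting at the boundary sources, and $\mathrm{int}(e)$ is the number of their intersections with $e$ (base points not counted). **Winding.** $s(a,b)=+1,0,-1$ if the ordered pair $(a,b)$ is positively oriented, parallel, negatively oriented. For consecutive directed edges: $\mathrm{wind}(e,f)=\pm1$ if $s(e,f)=s(e,\mathfrak l)=s(\mathfrak l,f)=\pm1$; otherwise $0$. **Edge vectors.** The edge vectors are the unique solution of $E_e=(-1)^{\mathrm{int}(e)}w_e\sum_f(-1)^{\mathrm{wind}(e,f)}E_f$ (for every edge $e$ ending at an internal vertex $V$, $f$ running over the edges outgoing at $V$), with $E_{e_j}=(-1)^{\mathrm{int}(e_j)}w_{e_j}E_j$ at the edge $e_j$ ending at the sink $b_j$, $E_j$ being the $j$-th canonical basis vector of $\mathbb R^n$. **Weight gauge.**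 In general, the weight gauge transformation with positive numbers $t_V$ at internal vertices ($t_{b_i}=1$) is $w_e\mapsto w_et_Ut_V^{-1}$ for $e=(U,V)$ directed from $U$ to $V$. *)

theory Defs
  imports "HOL-Analysis.Analysis" "Graph_Theory.Graph_Theory"
begin

section \<open>Plabic networks\<close>

text \<open>
  A vertex is a point of the plane. The edges are straight, so an edge is determined by its
  end points and is represented by the pair (initial point, final point). The boundary vertices
  \<open>b\<^sub>1, \<dots>, b\<^sub>n\<close> are indexed by a finite linearly ordered type with \<open>n\<close> elements, which is also the
  index type of the coordinates of \<open>\<real>\<^sup>n\<close>. The perfect orientation is the direction of the arcs of
  the graph.
\<close>

type_synonym point = "real ^ 2"
type_synonym edge = "point \<times> point"

record 'n plabic_network =
  disk :: "point set"
  bvertex :: "'n \<Rightarrow> point"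
  graph :: "point pair_pre_digraph"
  white :: "point set"
  weight :: "edge \<Rightarrow> real"

abbreviation edges :: "('n, 'z) plabic_network_scheme \<Rightarrow> edge set" where
  "edges N \<equiv> parcs (graph N)"

abbreviation incoming :: "('n, 'z) plabic_network_scheme \<Rightarrow> point \<Rightarrow> edge set" where
  "incoming N v \<equiv> in_arcs (with_proj (graph N)) v"

abbreviation outgoing :: "('n, 'z) plabic_network_scheme \<Rightarrow> point \<Rightarrow> edge set" where
  "outgoing N v \<equiv> out_arcs (with_proj (graph N)) v"

definition internal :: "('n, 'z) plabic_network_scheme \<Rightarrow> point set" where
  "internal N = pverts (graph N) - range (bvertex N)"

abbreviation degree_at :: "('n, 'z) plabic_network_scheme \<Rightarrow> point \<Rightarrow> nat" where
  "degree_at N v \<equiv> in_degree (with_proj (graph N)) v + out_degree (with_proj (graph N)) v"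

definition is_source :: "('n, 'z) plabic_network_scheme \<Rightarrow> 'n \<Rightarrow> bool" where
  "is_source N j \<longleftrightarrow> outgoing N (bvertex N j) \<noteq> {}"

text \<open>The orientation \<open>s(a, b)\<close> of an ordered pair of vectors.\<close>

definition orient :: "point \<Rightarrow> point \<Rightarrow> int" where
  "orient a b = (let d = a $ 1 * b $ 2 - a $ 2 * b $ 1
                 in if d > 0 then 1 else if d < 0 then - 1 else 0)"

text \<open>
  The boundary segment \<open>[p, q]\<close> is traversed clockwise when the interior of the disk lies to the
  right of the vector \<open>q - p\<close>.
\<close>

definition boundary_on_segment :: "('n::linorder, 'z) plabic_network_scheme \<Rightarrow> bool" where
  "boundary_on_segment N \<longleftrightarrow>
     (\<exists>p q. p \<noteq> q \<and> closed_segment p q \<subseteq> frontier (disk N) \<and>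
        (\<forall>x\<in>interior (disk N). orient (q - p) (x - p) = - 1) \<and>
        range (bvertex N) \<subseteq> closed_segment p q \<and>
        (\<forall>i j. i < j \<longrightarrow> bvertex N i \<bullet> (q - p) < bvertex N j \<bullet> (q - p)))"

definition straight_embedding :: "point pair_pre_digraph \<Rightarrow> bool" where
  "straight_embedding G \<longleftrightarrow>
     (\<forall>e\<in>parcs G. open_segment (fst e) (snd e) \<inter> pverts G = {}) \<and>
     (\<forall>e\<in>parcs G. \<forall>f\<in>parcs G. e \<noteq> f \<longrightarrow>
        closed_segment (fst e) (snd e) \<inter> closed_segment (fst f) (snd f)
          \<subseteq> {fst e, snd e} \<inter> {fst f, snd f})"

text \<open>
  The colour is part of the data because that of a bivalent vertex is free. At a bivalent
  vertex either colour condition forces one incoming and one outgoing edge; at a trivalent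
  vertex the colour is determined by the orientation.
\<close>

definition plabic_network :: "('n::{finite, linorder}, 'z) plabic_network_scheme \<Rightarrow> bool" where
  "plabic_network N \<longleftrightarrow>
     compact (disk N) \<and> convex (disk N) \<and> interior (disk N) \<noteq> {} \<and>
     boundary_on_segment N \<and>
     pair_digraph (graph N) \<and>
     straight_embedding (graph N) \<and>
     range (bvertex N) \<subseteq> pverts (graph N) \<and>
     internal N \<subseteq> interior (disk N) \<and>
     (\<forall>j. degree_at N (bvertex N j) = 1) \<and>
     (\<forall>v\<in>internal N. degree_at N v \<in> {2, 3}) \<and>
     (\<forall>v\<in>pverts (graph N). \<exists>j. v \<rightarrow>\<^sup>*\<^bsub>with_proj (mk_symmetric (with_proj (graph N)))\<^esub> bvertex N j) \<and>
     white N \<subseteq> internal N \<and>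
     (\<forall>v\<in>white N. in_degree (with_proj (graph N)) v = 1) \<and>
     (\<forall>v\<in>internal N - white N. out_degree (with_proj (graph N)) v = 1) \<and>
     (\<forall>e\<in>edges N. weight N e > 0)"


section \<open>Gauge rays, intersection numbers and winding\<close>

abbreviation edge_dir :: "edge \<Rightarrow> point" where
  "edge_dir e \<equiv> snd e - fst e"

definition gauge_ray_direction :: "('n, 'z) plabic_network_scheme \<Rightarrow> point \<Rightarrow> bool" where
  "gauge_ray_direction N l \<longleftrightarrow>
     l \<noteq> 0 \<and>
     (\<forall>e\<in>edges N. orient (edge_dir e) l \<noteq> 0) \<and>
     (\<forall>j. (\<forall>\<^sub>F t in at_right 0. bvertex N j + t *\<^sub>R l \<in> interior (disk N)) \<and>
          (\<forall>t\<ge>0. bvertex N j + t *\<^sub>R l \<notin> internal N))"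

text \<open>
  An intersection is recorded as the index of the source together with the parameter along the
  ray; the condition \<open>t > 0\<close> discards the base point.
\<close>

definition int_number :: "('n, 'z) plabic_network_scheme \<Rightarrow> point \<Rightarrow> edge \<Rightarrow> nat" where
  "int_number N l e =
     card {(j, t::real). is_source N j \<and> t > 0 \<and>
                         bvertex N j + t *\<^sub>R l \<in> closed_segment (fst e) (snd e)}"

definition wind :: "point \<Rightarrow> edge \<Rightarrow> edge \<Rightarrow> int" where
  "wind l e f =
     (if orient (edge_dir e) (edge_dir f) = orient (edge_dir e) l \<and>
         orient (edge_dir e) l = orient l (edge_dir f)
      then orient (edge_dir e) (edge_dir f) else 0)"


section \<open>Edge vectors\<close>

definition edge_vector_system ::
    "('n::finite, 'z) plabic_network_scheme \<Rightarrow> point \<Rightarrow> (edge \<Rightarrow> real ^ 'n) \<Rightarrow> bool" where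
  "edge_vector_system N l E \<longleftrightarrow>
     (\<forall>e\<in>edges N. snd e \<in> internal N \<longrightarrow>
        E e = ((- 1) ^ int_number N l e * weight N e) *\<^sub>R
              (\<Sum>f\<in>outgoing N (snd e). (- 1) powi wind l e f *\<^sub>R E f)) \<and>
     (\<forall>e\<in>edges N. \<forall>j. snd e = bvertex N j \<longrightarrow>
        E e = ((- 1) ^ int_number N l e * weight N e) *\<^sub>R axis j 1)"

text \<open>The edge vectors are the unique solution; only values on the edges of the network matter.\<close>

definition edge_vectors ::
    "('n::finite, 'z) plabic_network_scheme \<Rightarrow> point \<Rightarrow> (edge \<Rightarrow> real ^ 'n) \<Rightarrow> bool" where
  "edge_vectors N l E \<longleftrightarrow>
     edge_vector_system N l E \<and>
     (\<forall>E'. edge_vector_system N l E' \<longrightarrow> (\<forall>e\<in>edges N. E' e = E e))"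


section \<open>Weight gauge transformations\<close>

definition weight_gauge ::
    "(point \<Rightarrow> real) \<Rightarrow> ('n, 'z) plabic_network_scheme \<Rightarrow> ('n, 'z) plabic_network_scheme" where
  "weight_gauge t N = N\<lparr>weight := (\<lambda>e. weight N e * t (fst e) * inverse (t (snd e)))\<rparr>"

definition vertex_gauge ::
    "point \<Rightarrow> real \<Rightarrow> ('n, 'z) plabic_network_scheme \<Rightarrow> ('n, 'z) plabic_network_scheme" where
  "vertex_gauge u c = weight_gauge ((\<lambda>_. 1)(u := c))"

end

theory Submission
  imports Defs
begin

text \<open>
  Multiplying \<open>E\<^sub>e\<close> by the gauge factor of the initial vertex of \<open>e\<close> maps the
  solutions of the linear system of a network bijectively onto those of the gauged network: in the
  equation of \<open>e = (U, V)\<close> the factor \<open>t\<^sub>V\<close> of the edges leaving \<open>V\<close> cancels the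
  \<open>t\<^sub>V\<inverse>\<close> in the weight of \<open>e\<close>. Hence uniqueness transfers as well.
\<close>

lemma weight_gauge_sel [simp]:
  "graph (weight_gauge t N) = graph N"
  "bvertex (weight_gauge t N) = bvertex N"
  "weight (weight_gauge t N) e = weight N e * t (fst e) * inverse (t (snd e))"
  by (simp_all add: weight_gauge_def)

lemma internal_weight_gauge [simp]: "internal (weight_gauge t N) = internal N"
  by (simp add: internal_def)

lemma int_number_weight_gauge [simp]: "int_number (weight_gauge t N) l e = int_number N l e"
  by (simp add: int_number_def is_source_def)

lemma in_outgoing_iff: "e \<in> outgoing N v \<longleftrightarrow> e \<in> edges N \<and> fst e = v"
  by (simp add: out_arcs_def)

lemma in_incoming_iff: "e \<in> incoming N v \<longleftrightarrow> e \<in> edges N \<and> snd e = v"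
  by (simp add: in_arcs_def)

text \<open>All vectors in the system, the summands over \<open>outgoing\<close> included, belong to
  edges, so values at pairs of points that are not edges do not matter.\<close>

lemma edge_vector_system_cong:
  assumes "\<And>e. e \<in> edges N \<Longrightarrow> E e = E' e"
  shows "edge_vector_system N l E \<longleftrightarrow> edge_vector_system N l E'"
proof -
  have "(\<Sum>f\<in>outgoing N v. (- 1) powi wind l e f *\<^sub>R E f) =
        (\<Sum>f\<in>outgoing N v. (- 1) powi wind l e f *\<^sub>R E' f)" for e v
    using assms by (intro sum.cong) (auto simp: in_outgoing_iff)
  with assms show ?thesis
    unfolding edge_vector_system_def by simp
qed

lemma edge_vectors_cong:
  assumes "\<And>e. e \<in> edges N \<Longrightarrow> E e = E' e"
  shows "edge_vectors N l E \<longleftrightarrow> edge_vectors N l E'"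
  using edge_vector_system_cong[of N E E' l] assms by (simp add: edge_vectors_def)

text \<open>The normalisation of \<open>t\<close> at the boundary is forced by the sinks: there the
  right-hand side is the fixed vector \<open>axis j 1\<close>, which absorbs no factor.\<close>

lemma edge_vector_system_weight_gauge:
  assumes t: "\<And>v. t v \<noteq> 0" "\<And>j. t (bvertex N j) = 1"
  shows "edge_vector_system (weight_gauge t N) l (\<lambda>e. t (fst e) *\<^sub>R E e) \<longleftrightarrow>
         edge_vector_system N l E"
proof -
  \<comment> \<open>All edges of this sum start at \<open>v\<close>, so they carry the common factor
    \<open>t v\<close>.\<close>
  have sum: "(\<Sum>f\<in>outgoing N v. (- 1) powi wind l e f *\<^sub>R t (fst f) *\<^sub>R E f) =
        t v *\<^sub>R (\<Sum>f\<in>outgoing N v. (- 1) powi wind l e f *\<^sub>R E f)" for e v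
    unfolding scaleR_sum_right by (intro sum.cong) (auto simp: in_outgoing_iff mult.commute)
  \<comment> \<open>The equation of an edge from \<open>a\<close> to an internal vertex
    \<open>b\<close>: \<open>s\<close> stands for the intersection sign, \<open>w\<close> for the
    weight, \<open>x\<close> for the edge vector and \<open>y\<close> for the sum at
    \<open>b\<close>.\<close>
  have cancel: "t a *\<^sub>R x = (s * (w * t a * inverse (t b))) *\<^sub>R t b *\<^sub>R y \<longleftrightarrow> x = (s * w) *\<^sub>R y"
    for a b s w and x y :: "real ^ 'n"
  proof -
    have "s * (w * t a * inverse (t b)) * t b = t a * (s * w)"
      using t(1)[of b] by simp
    then have "(s * (w * t a * inverse (t b))) *\<^sub>R t b *\<^sub>R y = t a *\<^sub>R (s * w) *\<^sub>R y"
      by (simp only: scaleR_scaleR)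
    then show ?thesis
      by (simp add: t(1) del: scaleR_scaleR)
  qed
  \<comment> \<open>The version for edges ending at a sink. Any boundary vertex can serve as
    \<open>b\<close> in \<open>cancel\<close>, as \<open>t\<close> is 1 there;
    \<open>bvertex N undefined\<close> is an arbitrary choice.\<close>
  have cancel1: "t a *\<^sub>R x = (s * (w * t a)) *\<^sub>R y \<longleftrightarrow> x = (s * w) *\<^sub>R y"
    for a s w and x y :: "real ^ 'n"
    using cancel[of a x s w "bvertex N undefined" y] by (simp add: t(2))
  show ?thesis
    unfolding edge_vector_system_def
    \<comment> \<open>The first pass reduces the equations at internal vertices, the second those at
      sinks.\<close>
    by (simp only: weight_gauge_sel internal_weight_gauge int_number_weight_gauge sum cancel)
      (simp add: t(2) cancel1)
qed

lemma edge_vectors_weight_gauge: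
  assumes t: "\<And>v. t v \<noteq> 0" "\<And>j. t (bvertex N j) = 1"
    and E: "edge_vectors N l E"
  shows "edge_vectors (weight_gauge t N) l (\<lambda>e. t (fst e) *\<^sub>R E e)"
  unfolding edge_vectors_def
proof (intro conjI allI impI)
  show "edge_vector_system (weight_gauge t N) l (\<lambda>e. t (fst e) *\<^sub>R E e)"
    using E by (simp add: edge_vector_system_weight_gauge t edge_vectors_def)
next
  fix E' assume E': "edge_vector_system (weight_gauge t N) l E'"
  \<comment> \<open>Any solution \<open>E'\<close> of the gauged system is the rescaling of its
    quotient by the factors \<open>t (fst e)\<close>. That quotient therefore solves the original
    system, where uniqueness applies.\<close>
  have "(\<lambda>e. t (fst e) *\<^sub>R inverse (t (fst e)) *\<^sub>R E' e) = E'"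
    using t(1) by simp
  then have "edge_vector_system N l (\<lambda>e. inverse (t (fst e)) *\<^sub>R E' e)"
    using E' edge_vector_system_weight_gauge[of t N l "\<lambda>e. inverse (t (fst e)) *\<^sub>R E' e"] t
    by simp
  then have "\<forall>e\<in>edges N. inverse (t (fst e)) *\<^sub>R E' e = E e"
    using E by (simp add: edge_vectors_def)
  then show "\<forall>e\<in>edges (weight_gauge t N). E' e = t (fst e) *\<^sub>R E e"
    using t(1) by (metis scaleR_scaleR right_inverse scaleR_one weight_gauge_sel(1))
qed

lemma edge_vectors_vertex_gauge:
  assumes "u \<in> internal N" "c \<noteq> 0" "edge_vectors N l E"
  shows "edge_vectors (vertex_gauge u c N) l
           (\<lambda>e. if e \<in> outgoing N u then c *\<^sub>R E e else E e)"
proof -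
  let ?t = "(\<lambda>_. 1)(u := c)"
  \<comment> \<open>An internal \<open>u\<close> differs from every boundary vertex, so the update
    at \<open>u\<close> leaves the value 1 there.\<close>
  have "?t (bvertex N j) = 1" for j
    using assms(1) by (auto simp: internal_def)
  then have "edge_vectors (weight_gauge ?t N) l (\<lambda>e. ?t (fst e) *\<^sub>R E e)"
    using assms by (intro edge_vectors_weight_gauge) auto
  \<comment> \<open>The two families agree on edges only: at a pair that starts at \<open>u\<close>
    without being an edge, one has the factor \<open>c\<close> and the other does not.\<close>
  then show ?thesis
    unfolding vertex_gauge_def
    by (rule edge_vectors_cong[THEN iffD1, rotated]) (auto simp: in_outgoing_iff)
qed

lemma weight_vertex_gauge:
  assumes "pair_digraph (graph N)"
  shows "e \<in> outgoing N u \<Longrightarrow> weight (vertex_gauge u c N) e = c * weight N e"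
    and "e \<in> incoming N u \<Longrightarrow> weight (vertex_gauge u c N) e = inverse c * weight N e"
    and "e \<in> edges N - outgoing N u - incoming N u \<Longrightarrow>
           weight (vertex_gauge u c N) e = weight N e"
proof -
  \<comment> \<open>On a loop at \<open>u\<close> the factors \<open>c\<close> and
    \<open>inverse c\<close> would cancel, so loops must be excluded.\<close>
  have "fst e \<noteq> snd e" if "e \<in> edges N"
    using pair_loopfree_digraph.pair_no_loops pair_digraph.axioms(2) assms that by blast
  then show "e \<in> outgoing N u \<Longrightarrow> weight (vertex_gauge u c N) e = c * weight N e"
    and "e \<in> incoming N u \<Longrightarrow> weight (vertex_gauge u c N) e = inverse c * weight N e"
    unfolding in_outgoing_iff in_incoming_iff by (auto simp: vertex_gauge_def)
  show "weight (vertex_gauge u c N) e = weight N e"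
    if "e \<in> edges N - outgoing N u - incoming N u"
    using that unfolding Diff_iff in_outgoing_iff in_incoming_iff
    by (auto simp: vertex_gauge_def)
qed

theorem lemma4p10:
  fixes N :: "'n::{finite, linorder} plabic_network"
    and l :: point
    and E :: "edge \<Rightarrow> real ^ 'n::{finite, linorder}"
  assumes "plabic_network N"
    and "gauge_ray_direction N l"
    and "edge_vectors N l E"
  shows
    "(\<forall>u e1 e2 e3. \<forall>tu>0.
        u \<in> internal N \<and> u \<in> white N \<and> incoming N u = {e3} \<and> outgoing N u = {e1, e2} \<and> e1 \<noteq> e2 \<longrightarrow>
        (let N' = vertex_gauge u tu N in
           weight N' e1 = tu * weight N e1 \<and>
           weight N' e2 = tu * weight N e2 \<and>
           weight N' e3 = inverse tu * weight N e3 \<and>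
           (\<forall>e\<in>edges N - {e1, e2, e3}. weight N' e = weight N e) \<and>
           edge_vectors N' l (\<lambda>e. if e = e1 \<or> e = e2 then tu *\<^sub>R E e else E e))) \<and>
     (\<forall>v e1 e2 e3. \<forall>tv>0.
        v \<in> internal N \<and> v \<notin> white N \<and> incoming N v = {e2, e3} \<and> e2 \<noteq> e3 \<and> outgoing N v = {e1} \<longrightarrow>
        (let N' = vertex_gauge v tv N in
           weight N' e1 = tv * weight N e1 \<and>
           weight N' e2 = inverse tv * weight N e2 \<and>
           weight N' e3 = inverse tv * weight N e3 \<and>
           (\<forall>e\<in>edges N - {e1, e2, e3}. weight N' e = weight N e) \<and>
           edge_vectors N' l (\<lambda>e. if e = e1 then tv *\<^sub>R E e else E e)))"
proof -
  have G: "pair_digraph (graph N)"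
    using assms(1) by (simp add: plabic_network_def)
  \<comment> \<open>Quantifying over the sets of arcs allows the explicit sets of either case to be
    substituted, which leaves claims about \<open>e1\<close>, \<open>e2\<close> and
    \<open>e3\<close>.\<close>
  have weights: "\<forall>e\<in>outgoing N v. weight (vertex_gauge v c N) e = c * weight N e"
    "\<forall>e\<in>incoming N v. weight (vertex_gauge v c N) e = inverse c * weight N e"
    "\<forall>e\<in>edges N - outgoing N v - incoming N v. weight (vertex_gauge v c N) e = weight N e"
    for v c
    using weight_vertex_gauge[OF G] by blast+
  note vectors = edge_vectors_vertex_gauge[OF _ _ assms(3)]
  show ?thesis
  proof (intro conjI allI impI; elim conjE)
    fix u e1 e2 e3 and tu :: real
    assume *: "tu > 0" "u \<in> internal N" "incoming N u = {e3}" "outgoing N u = {e1, e2}"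
    show "let N' = vertex_gauge u tu N in
           weight N' e1 = tu * weight N e1 \<and>
           weight N' e2 = tu * weight N e2 \<and>
           weight N' e3 = inverse tu * weight N e3 \<and>
           (\<forall>e\<in>edges N - {e1, e2, e3}. weight N' e = weight N e) \<and>
           edge_vectors N' l (\<lambda>e. if e = e1 \<or> e = e2 then tu *\<^sub>R E e else E e)"
      using weights[of u tu, unfolded *(3,4)] vectors[of u tu, unfolded *(4)] *(1,2)
      by (simp add: Let_def)
  next
    fix v e1 e2 e3 and tv :: real
    assume *: "tv > 0" "v \<in> internal N" "incoming N v = {e2, e3}" "outgoing N v = {e1}"
    show "let N' = vertex_gauge v tv N in
           weight N' e1 = tv * weight N e1 \<and>
           weight N' e2 = inverse tv * weight N e2 \<and>
           weight N' e3 = inverse tv * weight N e3 \<and>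
           (\<forall>e\<in>edges N - {e1, e2, e3}. weight N' e = weight N e) \<and>
           edge_vectors N' l (\<lambda>e. if e = e1 then tv *\<^sub>R E e else E e)"
      using weights[of v tv, unfolded *(3,4)] vectors[of v tv, unfolded *(4)] *(1,2)
      by (simp add: Let_def)
  qed
qed

end
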